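(* Let $m_1,m_2\ge 1$. The complete bipartite graph $K_{m_1,m_2}$ of order $m=m_1+m_2$ is positively and negatively pseudo-invertible. The pseudo-inverse graph $(K_{m_1,m_2})^\dagger$ is the weighted bipartite graph $K_{m_1,m_2}$ with all edge weights equal to $1/(m_1m_2)$.
   Context: For a real symmetric matrix $A$, $A^\dagger$ denotes its Moore-Penrose inverse. $A^\dagger$ is called positively (negatively) signable if there exists a diagonal matrix $D$ with diagonal entries in $\{+1,-1\}$ such that all entries of $DA^\dagger D$ are non-negative (non-positive). A graph $G^A$ with adjacency matrix $A$ is called positively (negatively) pseudo-invertible if $A^\dagger$ is positively (negatively) signable. In that case its pseudo-inverse graph $(G^A)^\dagger$ is the undirected weighted graph whose (weighted, non-negative, symmetric) adjacency matrix is $DA^\dagger D$ if $A^\dagger$ is positively signable with signature matrix $D$, respectively $-DA^\dagger D$ if $A^\dagger$ is negatively signable with signature matrix $D$. "Positively and negatively" means both properties hold (possibly with different $D$). *)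

theory Defs
  imports "Graph_Theory.Graph_Theory" "Jordan_Normal_Form.Matrix"
begin

section \<open>The Moore-Penrose inverse and signability\<close>

definition is_moore_penrose :: "real mat \<Rightarrow> real mat \<Rightarrow> bool" where
  "is_moore_penrose A X \<longleftrightarrow>
     X \<in> carrier_mat (dim_col A) (dim_row A) \<and>
     A * X * A = A \<and> X * A * X = X \<and>
     transpose_mat (A * X) = A * X \<and> transpose_mat (X * A) = X * A"

definition pinv :: "real mat \<Rightarrow> real mat" where
  "pinv A = (THE X. is_moore_penrose A X)"

lemma is_moore_penrose_unique:
  assumes "is_moore_penrose A X" and "is_moore_penrose A Y"
  shows "X = Y"
proof -
  define n m where "n = dim_row A" and "m = dim_col A"
  have A: "A \<in> carrier_mat n m" by (auto simp: n_def m_def)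
  have X: "X \<in> carrier_mat m n" and Y: "Y \<in> carrier_mat m n"
    using assms by (auto simp: is_moore_penrose_def n_def m_def)
  have x: "A * X * A = A" "X * A * X = X"
      "transpose_mat (A * X) = A * X" "transpose_mat (X * A) = X * A"
    and y: "A * Y * A = A" "Y * A * Y = Y"
      "transpose_mat (A * Y) = A * Y" "transpose_mat (Y * A) = Y * A"
    using assms by (auto simp: is_moore_penrose_def)
  have AX: "A * X \<in> carrier_mat n n" and AY: "A * Y \<in> carrier_mat n n"
    and XA: "X * A \<in> carrier_mat m m" and YA: "Y * A \<in> carrier_mat m m"
    using A X Y by auto
  have a1: "(A * Y) * (A * X) = A * X"
    using assoc_mult_mat[OF AY A X] y(1) by simp
  have a2: "(A * X) * (A * Y) = A * Y"
    using assoc_mult_mat[OF AX A Y] x(1) by simp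
  have AXY: "A * X = A * Y"
    using transpose_mult[OF AY AX] a1 a2 x(3) y(3) by simp
  have b1: "(X * A) * (Y * A) = X * A"
    using assoc_mult_mat[OF X A YA] assoc_mult_mat[OF A Y A] y(1) by simp
  have b2: "(Y * A) * (X * A) = Y * A"
    using assoc_mult_mat[OF Y A XA] assoc_mult_mat[OF A X A] x(1) by simp
  have XYA: "X * A = Y * A"
    using transpose_mult[OF XA YA] b1 b2 x(4) y(4) by simp
  have "X = Y * A * X" using x(2) XYA by simp
  also have "\<dots> = Y * A * Y"
    using assoc_mult_mat[OF Y A X] assoc_mult_mat[OF Y A Y] AXY by simp
  finally show ?thesis using y(2) by simp
qed

lemma pinv_eqI: "is_moore_penrose A X \<Longrightarrow> pinv A = X"
  unfolding pinv_def using is_moore_penrose_unique by blast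

definition signature_mat :: "nat \<Rightarrow> real mat \<Rightarrow> bool" where
  "signature_mat n D \<longleftrightarrow>
     D \<in> carrier_mat n n \<and> diagonal_mat D \<and> (\<forall>i<n. D $$ (i, i) \<in> {1, -1})"

definition positively_signable_by :: "real mat \<Rightarrow> real mat \<Rightarrow> bool" where
  "positively_signable_by B D \<longleftrightarrow> signature_mat (dim_row B) D \<and>
     (\<forall>i < dim_row B. \<forall>j < dim_col B. (D * B * D) $$ (i, j) \<ge> 0)"

definition negatively_signable_by :: "real mat \<Rightarrow> real mat \<Rightarrow> bool" where
  "negatively_signable_by B D \<longleftrightarrow> signature_mat (dim_row B) D \<and>
     (\<forall>i < dim_row B. \<forall>j < dim_col B. (D * B * D) $$ (i, j) \<le> 0)"

definition positively_signable :: "real mat \<Rightarrow> bool" where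
  "positively_signable B \<longleftrightarrow> (\<exists>D. positively_signable_by B D)"

definition negatively_signable :: "real mat \<Rightarrow> bool" where
  "negatively_signable B \<longleftrightarrow> (\<exists>D. negatively_signable_by B D)"

section \<open>Weighted graphs and their pseudo-inverses\<close>

text \<open>
  A weighted graph is a symmetric digraph without parallel arcs (loops are allowed), together
  with a weight on its arcs. The vertices are the matrix indices below the order of the graph.
  Weights are positive, so the edges are exactly the non-zero entries of the adjacency matrix;
  values of the weight function off the arcs are irrelevant.
\<close>

definition weighted_graph :: "nat pair_pre_digraph \<Rightarrow> (nat \<times> nat) weight_fun \<Rightarrow> bool" where
  "weighted_graph G w \<longleftrightarrow> pair_pseudo_graph G \<and> pverts G = {..<card (pverts G)} \<and>
     (\<forall>(u, v) \<in> parcs G. w (u, v) > 0 \<and> w (v, u) = w (u, v))"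

definition adjacency_mat :: "nat pair_pre_digraph \<Rightarrow> (nat \<times> nat) weight_fun \<Rightarrow> real mat" where
  "adjacency_mat G w = mat (card (pverts G)) (card (pverts G))
     (\<lambda>(u, v). if (u, v) \<in> parcs G then w (u, v) else 0)"

text \<open>An unweighted graph is the weighted graph with this weight, i.e. with 0/1 adjacency matrix.\<close>

abbreviation unit_weight :: "(nat \<times> nat) weight_fun" where
  "unit_weight \<equiv> (\<lambda>_. 1)"

definition positively_pseudo_invertible ::
  "nat pair_pre_digraph \<Rightarrow> (nat \<times> nat) weight_fun \<Rightarrow> bool" where
  "positively_pseudo_invertible G w \<longleftrightarrow> positively_signable (pinv (adjacency_mat G w))"

definition negatively_pseudo_invertible ::
  "nat pair_pre_digraph \<Rightarrow> (nat \<times> nat) weight_fun \<Rightarrow> bool" where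
  "negatively_pseudo_invertible G w \<longleftrightarrow> negatively_signable (pinv (adjacency_mat G w))"

text \<open>
  Being a pseudo-inverse graph is a relation, because a graph may admit several signature
  matrices, of either kind.
\<close>

definition is_pseudo_inverse_graph ::
  "nat pair_pre_digraph \<Rightarrow> (nat \<times> nat) weight_fun \<Rightarrow>
   nat pair_pre_digraph \<Rightarrow> (nat \<times> nat) weight_fun \<Rightarrow> bool" where
  "is_pseudo_inverse_graph G w H w' \<longleftrightarrow> weighted_graph H w' \<and>
     (let B = pinv (adjacency_mat G w) in
       (\<exists>D. positively_signable_by B D \<and> adjacency_mat H w' = D * B * D) \<or>
       (\<exists>D. negatively_signable_by B D \<and> adjacency_mat H w' = - (D * B * D)))"

end

theory Submission
  imports Defs
begin

text \<open>
  Let \<open>A\<close> be the adjacency matrix of the complete bipartite graph with parts \<open>U\<close> and \<open>V\<close> of sizes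
  \<open>m1\<close> and \<open>m2\<close>. Two vertices of \<open>U\<close> have the \<open>m2\<close> vertices of \<open>V\<close> as common neighbours, two
  vertices of \<open>V\<close> have \<open>m1\<close> common neighbours, and vertices of different parts have none. Counting
  walks of length three therefore gives \<open>A\<^sup>3 = m1 m2 A\<close> (\<open>complete_bipartite_cube\<close>). A symmetric
  matrix with \<open>A\<^sup>3 = c A\<close> and \<open>c \<noteq> 0\<close> has the Moore-Penrose inverse \<open>A / c\<close>
  (\<open>pinv_symmetric_cube\<close>), so the pseudo-inverse of \<open>A\<close> is the adjacency matrix of the same graph
  with all weights \<open>1 / (m1 m2)\<close>.

  This matrix is non-negative, so the identity signs it positively. It vanishes inside the two
  parts, so flipping the signs of the vertices of \<open>U\<close> makes it non-positive.

  There are further signature matrices, but all of them lead to the same graph: conjugation by a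
  signature matrix changes entries only in sign, and the result is required to be non-negative
  (\<open>is_pseudo_inverse_graph_iff_nonneg\<close>). Finally a weighted graph is determined by its adjacency
  matrix, since weights are positive (\<open>adjacency_mat_determines_graph\<close>).
\<close>

section \<open>Conjugation by signature matrices\<close>

lemma mult_mat_entry:
  fixes P Q :: "real mat"
  assumes "P \<in> carrier_mat n n" and "Q \<in> carrier_mat n n" and "i < n" and "j < n"
  shows "(P * Q) $$ (i, j) = (\<Sum>k<n. P $$ (i, k) * Q $$ (k, j))"
  using assms by (auto simp: scalar_prod_def lessThan_atLeast0 intro!: sum.cong)

lemma signature_conj_entry:
  assumes "signature_mat n D" and "B \<in> carrier_mat n n" and "i < n" and "j < n"
  shows "(D * B * D) $$ (i, j) = D $$ (i, i) * B $$ (i, j) * D $$ (j, j)"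
proof -
  have D: "D \<in> carrier_mat n n"
    using assms(1) by (simp add: signature_mat_def)
  have diag: "D $$ (k, l) = 0" if "k < n" "l < n" "k \<noteq> l" for k l
    using assms(1) that by (auto simp: signature_mat_def diagonal_mat_def)
  have DB: "(D * B) $$ (i, l) = D $$ (i, i) * B $$ (i, l)" if "l < n" for l
  proof -
    have "(D * B) $$ (i, l) = (\<Sum>k<n. D $$ (i, k) * B $$ (k, l))"
      using mult_mat_entry[OF D assms(2,3) that] .
    also have "\<dots> = (\<Sum>k<n. if k = i then D $$ (i, i) * B $$ (i, l) else 0)"
      by (rule sum.cong) (use diag assms(3) in auto)
    finally show ?thesis using assms(3) by simp
  qed
  have "(D * B * D) $$ (i, j) = (\<Sum>k<n. (D * B) $$ (i, k) * D $$ (k, j))"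
    using mult_mat_entry[OF mult_carrier_mat[OF D assms(2)] D assms(3,4)] .
  also have "\<dots> = (\<Sum>k<n. if k = j then (D * B) $$ (i, j) * D $$ (j, j) else 0)"
    by (rule sum.cong) (use diag assms(4) in auto)
  finally show ?thesis using DB assms(4) by simp
qed

lemma abs_signature_conj_entry:
  assumes "signature_mat n D" and "B \<in> carrier_mat n n" and "i < n" and "j < n"
  shows "\<bar>(D * B * D) $$ (i, j)\<bar> = \<bar>B $$ (i, j)\<bar>"
proof -
  have "\<bar>D $$ (k, k)\<bar> = 1" if "k < n" for k
    using assms(1) that by (auto simp: signature_mat_def)
  then show ?thesis
    using signature_conj_entry[OF assms] assms(3,4) by (simp add: abs_mult)
qed

lemma signature_one_mat: "signature_mat n (1\<^sub>m n)"
  by (auto simp: signature_mat_def diagonal_mat_def)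

lemma positively_signable_by_one_mat:
  assumes "B \<in> carrier_mat n n" and "\<And>i j. i < n \<Longrightarrow> j < n \<Longrightarrow> B $$ (i, j) \<ge> 0"
  shows "positively_signable_by B (1\<^sub>m n)"
  using assms signature_one_mat[of n] by (auto simp: positively_signable_by_def)

text \<open>
  The signature matrix with \<open>-1\<close> exactly at the indices in \<open>U\<close> flips the entries between \<open>U\<close> and
  its complement; these are all the non-zero entries.
\<close>

lemma negatively_signable_bipartite:
  assumes B: "B \<in> carrier_mat n n" and nonneg: "\<And>i j. i < n \<Longrightarrow> j < n \<Longrightarrow> B $$ (i, j) \<ge> 0"
    and bipartite: "\<And>i j. i < n \<Longrightarrow> j < n \<Longrightarrow> i \<in> U \<longleftrightarrow> j \<in> U \<Longrightarrow> B $$ (i, j) = 0"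
  shows "negatively_signable B"
proof -
  define D :: "real mat"
    where "D = mat n n (\<lambda>(i, j). if i \<noteq> j then 0 else if i \<in> U then - 1 else 1)"
  have D: "signature_mat n D"
    by (auto simp: D_def signature_mat_def diagonal_mat_def)
  have "(D * B * D) $$ (i, j) \<le> 0" if "i < n" "j < n" for i j
    unfolding signature_conj_entry[OF D B that]
    using that nonneg[OF that] bipartite[OF that] by (auto simp: D_def)
  then show ?thesis
    using D B by (auto simp: negatively_signable_def negatively_signable_by_def)
qed

section \<open>Pseudo-inverse graphs and adjacency matrices\<close>

lemma adjacency_mat_carrier: "adjacency_mat G w \<in> carrier_mat (card (pverts G)) (card (pverts G))"
  by (simp add: adjacency_mat_def)

lemma adjacency_mat_entry:
  assumes "weighted_graph G w" and "i < card (pverts G)" and "j < card (pverts G)"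
  shows "adjacency_mat G w $$ (i, j) = (if (i, j) \<in> parcs G then w (i, j) else 0)"
  using assms by (simp add: adjacency_mat_def)

lemma adjacency_mat_nonneg:
  assumes "weighted_graph G w" and "i < card (pverts G)" and "j < card (pverts G)"
  shows "adjacency_mat G w $$ (i, j) \<ge> 0"
proof -
  have "w (i, j) > 0" if "(i, j) \<in> parcs G"
    using assms(1) that by (auto simp: weighted_graph_def)
  then show ?thesis using adjacency_mat_entry[OF assms] by (simp add: less_imp_le)
qed

lemma weighted_graph_arcs:
  assumes "weighted_graph G w"
  shows "(i, j) \<in> parcs G \<longleftrightarrow>
    i < card (pverts G) \<and> j < card (pverts G) \<and> adjacency_mat G w $$ (i, j) \<noteq> 0"
proof
  assume ij: "(i, j) \<in> parcs G"
  have "pair_wf_digraph G"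
    using assms by (simp add: weighted_graph_def pair_pseudo_graph_def pair_fin_digraph_def)
  then have "i \<in> pverts G" "j \<in> pverts G"
    using ij pair_wf_digraph.in_arcsD1 pair_wf_digraph.in_arcsD2 by metis+
  moreover have "pverts G = {..<card (pverts G)}" "w (i, j) > 0"
    using assms ij by (auto simp: weighted_graph_def)
  ultimately have "i < card (pverts G)" "j < card (pverts G)" "w (i, j) > 0"
    by (metis lessThan_iff)+
  then show "i < card (pverts G) \<and> j < card (pverts G) \<and> adjacency_mat G w $$ (i, j) \<noteq> 0"
    using ij adjacency_mat_entry[OF assms] by simp
qed (use adjacency_mat_entry[OF assms] in \<open>auto split: if_splits\<close>)

text \<open>
  The arcs are the positions of the non-zero entries and the weights are their values; the order of
  the graph is the dimension of the matrix. Hence equality of the adjacency matrices leaves only the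
  values of the weight functions off the arcs undetermined.
\<close>

lemma adjacency_mat_determines_graph:
  assumes "weighted_graph G w"
  shows "weighted_graph H w' \<and> adjacency_mat H w' = adjacency_mat G w \<longleftrightarrow>
    H = G \<and> (\<forall>e \<in> parcs G. w' e = w e)"
proof
  assume "weighted_graph H w' \<and> adjacency_mat H w' = adjacency_mat G w"
  then have H: "weighted_graph H w'" and eq: "adjacency_mat H w' = adjacency_mat G w"
    by auto
  have card: "card (pverts H) = card (pverts G)"
    using arg_cong[OF eq, of dim_row] by (simp add: adjacency_mat_def)
  have "pverts H = pverts G"
    using assms H card by (metis weighted_graph_def)
  moreover have arcs: "parcs H = parcs G"
    using weighted_graph_arcs[OF assms] weighted_graph_arcs[OF H] by (auto simp: card eq)
  moreover have "w' (i, j) = w (i, j)" if "(i, j) \<in> parcs G" for i j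
  proof -
    have ij: "i < card (pverts G)" "j < card (pverts G)"
      using weighted_graph_arcs[OF assms] that by auto
    show ?thesis
      using adjacency_mat_entry[OF assms ij] adjacency_mat_entry[OF H] ij that
      by (simp add: card eq arcs)
  qed
  ultimately show "H = G \<and> (\<forall>e \<in> parcs G. w' e = w e)"
    by auto
next
  assume *: "H = G \<and> (\<forall>e \<in> parcs G. w' e = w e)"
  have sym: "(v, u) \<in> parcs G" if "(u, v) \<in> parcs G" for u v
    using assms that pair_sym_digraph.pair_sym_arcs[of G]
    by (auto simp: weighted_graph_def pair_pseudo_graph_def symmetric_def sym_def)
  have "weighted_graph G w'"
    using assms * sym by (fastforce simp: weighted_graph_def)
  moreover have "adjacency_mat G w' = adjacency_mat G w"
    using * by (auto simp: adjacency_mat_def)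
  ultimately show "weighted_graph H w' \<and> adjacency_mat H w' = adjacency_mat G w"
    using * by simp
qed

text \<open>
  When the pseudo-inverse is already non-negative, every admissible choice of a signature matrix,
  of either kind, gives back the pseudo-inverse itself: the sign is fixed by signability and the
  absolute value is unchanged by the conjugation.
\<close>

lemma is_pseudo_inverse_graph_iff_nonneg:
  assumes pinv: "pinv (adjacency_mat G w) = B" and B: "B \<in> carrier_mat n n"
    and nonneg: "\<And>i j. i < n \<Longrightarrow> j < n \<Longrightarrow> B $$ (i, j) \<ge> 0"
  shows "is_pseudo_inverse_graph G w H w' \<longleftrightarrow> weighted_graph H w' \<and> adjacency_mat H w' = B"
proof -
  have pos: "D * B * D = B" if "positively_signable_by B D" for D
  proof (rule eq_matI)
    have D: "signature_mat n D" using that B by (simp add: positively_signable_by_def)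
    then show "dim_row (D * B * D) = dim_row B" "dim_col (D * B * D) = dim_col B"
      using B by (auto simp: signature_mat_def)
    fix i j assume "i < dim_row B" "j < dim_col B"
    then have ij: "i < n" "j < n" and "(D * B * D) $$ (i, j) \<ge> 0"
      using that B by (auto simp: positively_signable_by_def)
    then show "(D * B * D) $$ (i, j) = B $$ (i, j)"
      using abs_signature_conj_entry[OF D B ij] nonneg[OF ij] by linarith
  qed
  have neg: "- (D * B * D) = B" if "negatively_signable_by B D" for D
  proof (rule eq_matI)
    have D: "signature_mat n D" using that B by (simp add: negatively_signable_by_def)
    then show dims: "dim_row (- (D * B * D)) = dim_row B" "dim_col (- (D * B * D)) = dim_col B"
      using B by (auto simp: signature_mat_def)
    fix i j assume ij': "i < dim_row B" "j < dim_col B"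
    then have ij: "i < n" "j < n" and "(D * B * D) $$ (i, j) \<le> 0"
      using that B by (auto simp: negatively_signable_by_def)
    then have "- (D * B * D) $$ (i, j) = B $$ (i, j)"
      using abs_signature_conj_entry[OF D B ij] nonneg[OF ij] by linarith
    then show "(- (D * B * D)) $$ (i, j) = B $$ (i, j)"
      using ij' dims by simp
  qed
  have "positively_signable_by B (1\<^sub>m n)"
    using positively_signable_by_one_mat[OF B] nonneg by blast
  then show ?thesis
    unfolding is_pseudo_inverse_graph_def Let_def pinv using pos neg by metis
qed

section \<open>The pseudo-inverse of a complete bipartite graph\<close>

lemma pinv_symmetric_cube:
  assumes A: "A \<in> carrier_mat n n" and sym: "transpose_mat A = A"
    and cube: "A * A * A = c \<cdot>\<^sub>m A" and "c \<noteq> 0"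
  shows "pinv A = (1 / c) \<cdot>\<^sub>m A"
proof (rule pinv_eqI)
  let ?X = "(1 / c) \<cdot>\<^sub>m A"
  have AX: "A * ?X = (1 / c) \<cdot>\<^sub>m (A * A)" and XA: "?X * A = (1 / c) \<cdot>\<^sub>m (A * A)"
    using A by (auto simp: mult_smult_distrib mult_smult_assoc_mat)
  have AA: "A * A \<in> carrier_mat n n" using A by simp
  have "A * ?X * A = (1 / c) \<cdot>\<^sub>m (A * A * A)"
    unfolding AX using mult_smult_assoc_mat[OF AA A] by simp
  also have "\<dots> = A"
    unfolding cube using \<open>c \<noteq> 0\<close> by (intro eq_matI) auto
  finally have AXA: "A * ?X * A = A" .
  have "?X * A \<in> carrier_mat n n" unfolding XA using AA by simp
  then have "?X * A * ?X = (1 / c) \<cdot>\<^sub>m (?X * A * A)"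
    by (rule mult_smult_distrib[OF _ A])
  also have "?X * A * A = A" using AXA AX XA by simp
  finally have XAX: "?X * A * ?X = ?X" .
  have "transpose_mat (k \<cdot>\<^sub>m M) = k \<cdot>\<^sub>m transpose_mat M" for k and M :: "real mat"
    by (rule eq_matI) auto
  then have "transpose_mat ((1 / c) \<cdot>\<^sub>m (A * A)) = (1 / c) \<cdot>\<^sub>m (A * A)"
    using transpose_mult[OF A A] sym by simp
  then show "is_moore_penrose A ?X"
    unfolding is_moore_penrose_def using A AXA XAX AX XA by auto
qed

text \<open>
  Writing \<open>a\<close> and \<open>b\<close> for the indicator vectors of the parts, the matrix is \<open>a b\<^sup>T + b a\<^sup>T\<close>, where \<open>a\<close>
  and \<open>b\<close> are orthogonal with squared norms \<open>card U\<close> and \<open>card V\<close>. Hence its square is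
  \<open>card V a a\<^sup>T + card U b b\<^sup>T\<close>, and multiplying once more gives the claim.
\<close>

lemma complete_bipartite_cube:
  fixes U V :: "nat set"
  assumes UV: "U \<union> V = {..<n}" "U \<inter> V = {}"
    and A: "A = mat n n (\<lambda>e. if e \<in> U \<times> V \<union> V \<times> U then 1 else (0 :: real))"
  shows "A * A * A = (real (card U) * real (card V)) \<cdot>\<^sub>m A"
proof -
  define a b :: "nat \<Rightarrow> real" where "a = (\<lambda>i. if i \<in> U then 1 else 0)" and "b = (\<lambda>i. if i \<in> V then 1 else 0)"
  have A_entry: "A $$ (i, j) = a i * b j + b i * a j" if "i < n" "j < n" for i j
    using that UV by (auto simp: A a_def b_def)
  have A_carrier: "A \<in> carrier_mat n n" by (simp add: A)
  have orth: "a k * b k = 0" and idem: "a k * a k = a k" "b k * b k = b k" for k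
    using UV(2) by (auto simp: a_def b_def)
  have sub: "U \<subseteq> {..<n}" "V \<subseteq> {..<n}" using UV by auto
  have sums: "(\<Sum>k<n. a k) = card U" "(\<Sum>k<n. b k) = card V"
    using sub by (auto simp: a_def b_def sum.If_cases Int_absorb1)
  have prod_entry: "(P * A) $$ (i, j) = (\<Sum>k<n. P $$ (i, k) * (a k * b j + b k * a j))"
    if "P \<in> carrier_mat n n" "i < n" "j < n" for P i j
    using mult_mat_entry[OF that(1) A_carrier that(2,3)] A_entry that(3) by simp
  have AA: "(A * A) $$ (i, j) = card V * (a i * a j) + card U * (b i * b j)"
    if "i < n" "j < n" for i j
  proof -
    have "(A * A) $$ (i, j) = (\<Sum>k<n. (a i * a j) * b k + (b i * b j) * a k)"
      unfolding prod_entry[OF A_carrier that]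
    proof (rule sum.cong)
      fix k assume "k \<in> {..<n}"
      have "(a i * b k + b i * a k) * (a k * b j + b k * a j)
        = (a i * b j + b i * a j) * (a k * b k)
          + (a i * a j) * (b k * b k) + (b i * b j) * (a k * a k)"
        by (simp add: algebra_simps)
      then show "A $$ (i, k) * (a k * b j + b k * a j) = (a i * a j) * b k + (b i * b j) * a k"
        using A_entry that \<open>k \<in> {..<n}\<close> by (simp add: orth idem)
    qed simp
    then show ?thesis
      by (simp add: sum.distrib sum_distrib_left[symmetric] sums)
  qed
  have "(A * A * A) $$ (i, j) = card U * card V * A $$ (i, j)" if "i < n" "j < n" for i j
  proof -
    have "(A * A * A) $$ (i, j)
      = (\<Sum>k<n. (card V * (a i * b j)) * a k + (card U * (b i * a j)) * b k)"
      unfolding prod_entry[OF mult_carrier_mat[OF A_carrier A_carrier] that]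
    proof (rule sum.cong)
      fix k assume "k \<in> {..<n}"
      have "(card V * (a i * a k) + card U * (b i * b k)) * (a k * b j + b k * a j)
        = (card V * (a i * a j) + card U * (b i * b j)) * (a k * b k)
          + (card V * (a i * b j)) * (a k * a k) + (card U * (b i * a j)) * (b k * b k)"
        by (simp add: algebra_simps)
      then show "(A * A) $$ (i, k) * (a k * b j + b k * a j)
        = (card V * (a i * b j)) * a k + (card U * (b i * a j)) * b k"
        using AA that \<open>k \<in> {..<n}\<close> by (simp add: orth idem)
    qed simp
    also have "\<dots> = card U * card V * (a i * b j + b i * a j)"
      unfolding sum.distrib sum_distrib_left[symmetric] sums by (simp add: algebra_simps)
    finally show ?thesis using A_entry[OF that] by simp
  qed
  then show ?thesis
    using A_carrier by (intro eq_matI) auto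
qed

theorem proposition2p5:
  fixes m1 m2 :: nat and G :: "nat pair_pre_digraph"
  assumes "m1 \<ge> 1" and "m2 \<ge> 1"
    and "pverts G = {..<m1 + m2}"
    and "complete_bipartite_digraph m1 m2 (with_proj G)"
  shows "positively_pseudo_invertible G unit_weight
       \<and> negatively_pseudo_invertible G unit_weight
       \<and> (\<forall>H w. is_pseudo_inverse_graph G unit_weight H w
             \<longleftrightarrow> H = G \<and> (\<forall>e \<in> parcs G. w e = 1 / (real m1 * real m2)))"
proof -
  define n where "n = m1 + m2"
  define c where "c = real m1 * real m2"
  define B where "B = adjacency_mat G (\<lambda>_. 1 / c)"
  have c: "c > 0" using assms(1,2) by (simp add: c_def)
  have card: "card (pverts G) = n" using assms(3) by (simp add: n_def)
  obtain U V where UV: "U \<union> V = {..<n}" "U \<inter> V = {}" and cards: "card U = m1" "card V = m2"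
    and arcs: "parcs G = U \<times> V \<union> V \<times> U"
    using assms(3,4) unfolding complete_bipartite_digraph_pair_def n_def by metis
  have "pair_graph G"
    using assms(4) by (rule pair_graphI_complete_bipartite)
  then have weighted: "weighted_graph G (\<lambda>_. 1 / c)"
    using c assms(3) by (simp add: weighted_graph_def pair_graph_def case_prod_unfold)
  have B: "B \<in> carrier_mat n n"
    using adjacency_mat_carrier[of G] by (simp add: B_def card)
  have nonneg: "B $$ (i, j) \<ge> 0" if "i < n" "j < n" for i j
    using adjacency_mat_nonneg[OF weighted] that by (simp add: B_def card)

  let ?A = "adjacency_mat G unit_weight"
  have A: "?A = mat n n (\<lambda>e. if e \<in> U \<times> V \<union> V \<times> U then 1 else 0)"
    by (auto simp: adjacency_mat_def card arcs)
  have "?A * ?A * ?A = c \<cdot>\<^sub>m ?A"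
    using complete_bipartite_cube[OF UV A] by (simp add: c_def cards)
  moreover have "transpose_mat ?A = ?A"
    unfolding A by (rule eq_matI) auto
  ultimately have "pinv ?A = (1 / c) \<cdot>\<^sub>m ?A"
    using pinv_symmetric_cube[of ?A n c] c by (simp add: A)
  also have "\<dots> = B"
    by (rule eq_matI) (auto simp: B_def adjacency_mat_def)
  finally have pinv: "pinv ?A = B" .

  have "positively_pseudo_invertible G unit_weight"
    unfolding positively_pseudo_invertible_def pinv positively_signable_def
    using positively_signable_by_one_mat[OF B] nonneg by blast
  moreover have "negatively_pseudo_invertible G unit_weight"
    unfolding negatively_pseudo_invertible_def pinv
  proof (rule negatively_signable_bipartite[OF B nonneg])
    show "B $$ (i, j) = 0" if "i < n" "j < n" "i \<in> U \<longleftrightarrow> j \<in> U" for i j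
      using that UV by (auto simp: B_def adjacency_mat_def card arcs)
  qed
  moreover have "is_pseudo_inverse_graph G unit_weight H w \<longleftrightarrow>
      H = G \<and> (\<forall>e \<in> parcs G. w e = 1 / c)" for H w
    using is_pseudo_inverse_graph_iff_nonneg[OF pinv B nonneg]
      adjacency_mat_determines_graph[OF weighted] by (simp add: B_def)
  ultimately show ?thesis
    by (simp add: c_def)
qed

end
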